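(* Let $\lambda$ be a nonzero real number and $Y$ a random variable as in the context. Then, as formal power series, \[ \log_{\lambda}^{Y}(1+t)=\sum_{n=1}^{\infty}\sum_{j=0}^{n-1}\binom{2n-1}{n-1-j}(-1)^{j}E[Y]^{-n-j}S_{2,\lambda}^{Y}(n-1+j,j)\frac{t^{n}}{n!}. \]
   Context: $(x)_{0,\lambda}=1$, $(x)_{n,\lambda}=x(x-\lambda)\cdots(x-(n-1)\lambda)$ for $n\ge1$. $Y$ is a random variable whose moment-generating function $E[e^{tY}]$ exists for $|t|<r$ for some $r>0$, and $E[Y]\neq0$. $E[e_{\lambda}^{Y}(t)]$ denotes the formal power series $\sum_{n\ge0}E[(Y)_{n,\lambda}]\frac{t^n}{n!}$. The probabilistic degenerate Stirling numbers of the second kind: $\frac1{k!}\big(E[e_{\lambda}^{Y}(t)]-1\big)^k=\sum_{n\ge k}S_{2,\lambda}^{Y}(n,k)\frac{t^n}{n!}$. The probabilistic degenerate logarithm $\log_{\lambda}^{Y}(1+t)$ is defined as the compositional inverse of the delta series $E[e_{\lambda}^{Y}(t)]-1$. *)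

theory Defs
  imports "HOL-Probability.Probability" "HOL-Computational_Algebra.Formal_Power_Series"
begin

definition degenerate_ffact :: "real \<Rightarrow> real \<Rightarrow> nat \<Rightarrow> real" where
  "degenerate_ffact lam x n = (\<Prod>i<n. x - real i * lam)"

definition mgf_exists_near_0 :: "'a measure \<Rightarrow> ('a \<Rightarrow> real) \<Rightarrow> bool" where
  "mgf_exists_near_0 M Y \<longleftrightarrow>
     (\<exists>r>0. \<forall>t. \<bar>t\<bar> < r \<longrightarrow> integrable M (\<lambda>\<omega>. exp (t * Y \<omega>)))"

definition prob_degenerate_exp :: "'a measure \<Rightarrow> ('a \<Rightarrow> real) \<Rightarrow> real \<Rightarrow> real fps" where
  "prob_degenerate_exp M Y lam =
     Abs_fps (\<lambda>n. (\<integral>\<omega>. degenerate_ffact lam (Y \<omega>) n \<partial>M) / fact n)"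

definition prob_degenerate_Stirling2 ::
    "'a measure \<Rightarrow> ('a \<Rightarrow> real) \<Rightarrow> real \<Rightarrow> nat \<Rightarrow> nat \<Rightarrow> real" where
  "prob_degenerate_Stirling2 M Y lam n k =
     fact n * fps_nth (fps_const (1 / fact k) * (prob_degenerate_exp M Y lam - 1) ^ k) n"

text \<open>The series \<open>log(1 + t)\<close> in the variable \<open>t\<close>, that is, already expanded around 1.\<close>

definition prob_degenerate_log1p :: "'a measure \<Rightarrow> ('a \<Rightarrow> real) \<Rightarrow> real \<Rightarrow> real fps" where
  "prob_degenerate_log1p M Y lam = fps_inv (prob_degenerate_exp M Y lam - 1)"

lemma prob_degenerate_exp_nth_0:
  assumes "prob_space M"
  shows "fps_nth (prob_degenerate_exp M Y lam - 1) 0 = 0"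
  using prob_space.prob_space[OF assms]
  by (simp add: prob_degenerate_exp_def degenerate_ffact_def)

lemma prob_degenerate_exp_nth_1:
  "fps_nth (prob_degenerate_exp M Y lam - 1) 1 = (\<integral>\<omega>. Y \<omega> \<partial>M)"
  by (simp add: prob_degenerate_exp_def degenerate_ffact_def)

lemma prob_degenerate_Stirling2_gf:
  assumes "prob_space M"
  shows "fps_const (1 / fact k) * (prob_degenerate_exp M Y lam - 1) ^ k =
    Abs_fps (\<lambda>n. if n \<ge> k then prob_degenerate_Stirling2 M Y lam n k / fact n else 0)"
  using startsby_zero_power_prefix[OF prob_degenerate_exp_nth_0[OF assms]]
  by (auto simp: fps_eq_iff prob_degenerate_Stirling2_def)

lemma prob_degenerate_log1p_compositional_inverse:
  assumes "prob_space M" and "(\<integral>\<omega>. Y \<omega> \<partial>M) \<noteq> 0"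
  shows "prob_degenerate_log1p M Y lam oo (prob_degenerate_exp M Y lam - 1) = fps_X"
    and "(prob_degenerate_exp M Y lam - 1) oo prob_degenerate_log1p M Y lam = fps_X"
proof -
  have "fps_nth (prob_degenerate_exp M Y lam - 1) 1 \<noteq> 0"
    unfolding prob_degenerate_exp_nth_1 by (fact assms(2))
  note * = prob_degenerate_exp_nth_0[OF assms(1)] this
  show "prob_degenerate_log1p M Y lam oo (prob_degenerate_exp M Y lam - 1) = fps_X"
    unfolding prob_degenerate_log1p_def by (rule fps_inv[OF *])
  show "(prob_degenerate_exp M Y lam - 1) oo prob_degenerate_log1p M Y lam = fps_X"
    unfolding prob_degenerate_log1p_def by (rule fps_inv_right[OF *])
qed

end

theory Submission
  imports Defs
begin

text \<open>
  Lagrange inversion gives \<open>n [t\<^sup>n] f\<^sup>-\<^sup>1 = [t\<^sup>n\<^sup>-\<^sup>1] (t / f)\<^sup>n\<close>. Write \<open>f = a t h\<close> with \<open>h(0) = 1\<close>.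
  Expanding \<open>h\<^sup>-\<^sup>n\<close> binomially in \<open>h - 1\<close>, only the powers below \<open>n\<close> contribute to this coefficient;
  expanding these again in powers of \<open>h\<close> turns it into a combination of the coefficients of
  \<open>h\<^sup>j\<close>, \<open>j < n\<close>, which are the Stirling numbers up to normalisation.
\<close>

text \<open>With f = X F this is the residue of f' / f^(m+1), which vanishes because that quotient
  is the derivative of -f^(-m) / m. Working with powers of 1/F instead of 1/f keeps the argument
  inside power series.\<close>

lemma fps_nth_inverse_power_mult_deriv:
  fixes F :: "'a :: field_char_0 fps"
  assumes "fps_nth F 0 \<noteq> 0" and "m > 0"
  shows "fps_nth (inverse F ^ Suc m * fps_deriv (fps_X * F)) m = 0"
proof -
  define G where "G = inverse F"
  have GF: "G * F = 1"
    using assms(1) by (simp add: G_def inverse_mult_eq_1)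
  have "fps_deriv (G ^ m) = of_nat m * fps_deriv G * G ^ (m - 1)"
    by (simp add: fps_deriv_power fps_of_nat)
  also have "fps_deriv G = - fps_deriv F * G ^ 2"
    using assms(1) by (simp add: G_def fps_inverse_deriv)
  also have "of_nat m * (- fps_deriv F * G ^ 2) * G ^ (m - 1) = - of_nat m * fps_deriv F * G ^ Suc m"
    using assms(2) by (cases m) (simp_all add: power2_eq_square algebra_simps)
  finally have dG: "fps_deriv (G ^ m) = - of_nat m * fps_deriv F * G ^ Suc m" .
  have "of_nat m * (G ^ Suc m * fps_deriv (fps_X * F)) =
      of_nat m * (G ^ m * (G * F)) + fps_X * (of_nat m * fps_deriv F * G ^ Suc m)"
    by (simp add: algebra_simps)
  also have "\<dots> = of_nat m * G ^ m - fps_X * fps_deriv (G ^ m)"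
    unfolding dG GF by (simp add: algebra_simps)
  \<comment> \<open>X d/dX multiplies coefficient m by m, so the two terms cancel there.\<close>
  finally have "fps_nth (of_nat m * (G ^ Suc m * fps_deriv (fps_X * F))) m = 0"
    using assms(2) by (simp add: fps_of_nat [symmetric] del: power_Suc)
  thus ?thesis
    using assms(2) unfolding G_def by (simp add: fps_of_nat [symmetric] del: power_Suc)
qed

text \<open>The chain rule gives (g' o f) f' = 1. Multiply by F^(-n), expand g' o f in powers of f
  and read off coefficient n - 1: the summand i = n - 1 yields n times coefficient n of g, and every
  other summand is a vanishing residue.\<close>

theorem fps_Lagrange_inversion:
  fixes f g F :: "'a :: field_char_0 fps"
  assumes f: "f = fps_X * F" and F0: "fps_nth F 0 \<noteq> 0"
    and gf: "g oo f = fps_X" and "n > 0"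
  shows "of_nat n * fps_nth g n = fps_nth (inverse F ^ n) (n - 1)"
proof -
  define G where "G = inverse F"
  define D where "D = fps_deriv f"
  have GF: "G * F = 1"
    using F0 by (simp add: G_def inverse_mult_eq_1)
  have f0: "fps_nth f 0 = 0"
    by (simp add: f)
  have chain: "(fps_deriv g oo f) * D = 1"
    using fps_compose_deriv[OF f0, of g] gf by (simp add: D_def)
  have term_eq: "fps_nth (f ^ i * (D * G ^ n)) (n - 1) = (if i = n - 1 then 1 else 0)"
    if "i \<le> n - 1" for i
  proof -
    \<comment> \<open>Of the n factors \<open>G\<close>, i cancel the F^i inside
      \<open>f ^ i\<close>. At least one is left, so the exponent is a successor, as the residue
      lemma requires.\<close>
    have "G ^ n = G ^ i * G ^ Suc (n - 1 - i)"
      using that \<open>n > 0\<close> by (simp add: power_add [symmetric] del: power_Suc)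
    hence "f ^ i * (D * G ^ n) = fps_X ^ i * ((G * F) ^ i * (G ^ Suc (n - 1 - i) * D))"
      by (simp only: f power_mult_distrib mult_ac)
    also have "\<dots> = fps_X ^ i * (G ^ Suc (n - 1 - i) * D)"
      by (simp only: GF power_one mult_1)
    finally have "fps_nth (f ^ i * (D * G ^ n)) (n - 1) = fps_nth (G ^ Suc (n - 1 - i) * D) (n - 1 - i)"
      using that by (simp only: fps_X_power_mult_nth) auto
    also have "\<dots> = (if i = n - 1 then 1 else 0)"
    proof (cases "i = n - 1")
      case True
      thus ?thesis
        using F0 by (simp add: D_def f G_def fps_mult_nth)
    next
      case False
      thus ?thesis
        using that fps_nth_inverse_power_mult_deriv[OF F0, of "n - 1 - i"]
        by (simp add: D_def f G_def del: power_Suc)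
    qed
    finally show ?thesis .
  qed
  define A where "A = D * G ^ n"
  have "fps_nth (G ^ n) (n - 1) = fps_nth ((fps_deriv g oo f) * A) (n - 1)"
    using chain by (simp add: A_def mult.assoc [symmetric])
  also have "\<dots> = (\<Sum>k=0..n-1. \<Sum>i=0..k. fps_nth (fps_deriv g) i * fps_nth (f ^ i) k * fps_nth A (n - 1 - k))"
    by (simp add: fps_mult_nth fps_compose_nth sum_distrib_right)
  \<comment> \<open>\<open>f ^ i\<close> has order at least i, so the added terms with i > k vanish;
    with independent ranges the sums can be swapped.\<close>
  also have "\<dots> = (\<Sum>k=0..n-1. \<Sum>i=0..n-1. fps_nth (fps_deriv g) i * fps_nth (f ^ i) k * fps_nth A (n - 1 - k))"
    by (intro sum.cong sum.mono_neutral_left refl)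
       (auto simp: startsby_zero_power_prefix[OF f0])
  also have "\<dots> = (\<Sum>i=0..n-1. \<Sum>k=0..n-1. fps_nth (fps_deriv g) i * fps_nth (f ^ i) k * fps_nth A (n - 1 - k))"
    by (rule sum.swap)
  also have "\<dots> = (\<Sum>i=0..n-1. fps_nth (fps_deriv g) i * fps_nth (f ^ i * A) (n - 1))"
    by (simp only: fps_mult_nth sum_distrib_left mult.assoc)
  also have "\<dots> = (\<Sum>i=0..n-1. if i = n - 1 then fps_nth (fps_deriv g) i else 0)"
    unfolding A_def by (intro sum.cong refl, subst term_eq) auto
  also have "\<dots> = of_nat n * fps_nth g n"
    using \<open>n > 0\<close> by simp
  finally show ?thesis
    by (simp add: G_def)
qed

text \<open>Trinomial revision pulls out of each product a factor depending only on n and j; a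
  hockey-stick sum remains.\<close>

lemma sum_choose_mult_choose:
  assumes "j < n"
  shows "(\<Sum>k=j..n-1. ((n + k - 1) choose k) * (k choose j)) =
    ((n + j - 1) choose j) * ((2 * n - 1) choose (n - 1 - j))"
proof -
  have "(\<Sum>k=j..n-1. ((n + k - 1) choose k) * (k choose j)) =
      (\<Sum>k=j..n-1. ((n + j - 1) choose j) * ((n + k - 1) choose (k - j)))"
  proof (intro sum.cong refl)
    fix k assume k: "k \<in> {j..n-1}"
    have "(k choose j) = (k choose (k - j))"
      using k by (intro binomial_symmetric) auto
    thus "((n + k - 1) choose k) * (k choose j) = ((n + j - 1) choose j) * ((n + k - 1) choose (k - j))"
      using k assms choose_mult_lemma[of j "n - 1" "k - j"] by (simp add: mult.commute add.commute)
  qed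
  also have "\<dots> = ((n + j - 1) choose j) * (\<Sum>k=j..n-1. (n + k - 1) choose (k - j))"
    by (simp add: sum_distrib_left)
  also have "(\<Sum>k=j..n-1. (n + k - 1) choose (k - j)) = (\<Sum>i\<le>n-1-j. (n + j - 1 + i) choose i)"
    using assms by (intro sum.reindex_bij_witness[of _ "\<lambda>i. i + j" "\<lambda>k. k - j"]) (auto simp: algebra_simps)
  also have "\<dots> = (2 * n - 1) choose (n - 1 - j)"
  proof -
    have "Suc (n + j - 1 + (n - 1 - j)) = 2 * n - 1"
      using assms by linarith
    thus ?thesis
      by (simp only: sum_choose_lower)
  qed
  finally show ?thesis .
qed

text \<open>Interchanging the two binomial expansions collects at \<open>h ^ j\<close> exactly the
  sum evaluated by \<open>sum_choose_mult_choose\<close>.\<close>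

lemma fps_nth_inverse_power_eq_sum_powers:
  fixes h :: "'a :: field_char_0 fps"
  assumes h0: "fps_nth h 0 = 1" and "n > 0"
  shows "fps_nth (inverse h ^ n) (n - 1) =
    (\<Sum>j=0..n-1. (-1) ^ j * of_nat (((n + j - 1) choose j) * ((2 * n - 1) choose (n - 1 - j)))
        * fps_nth (h ^ j) (n - 1))"
proof -
  define u where "u = h - 1"
  have u0: "fps_nth u 0 = 0"
    by (simp add: u_def h0)
  have h: "h = 1 + u"
    by (simp add: u_def)
  \<comment> \<open>This is (1 + X)^(-n) at X = u. As u has no constant term, coefficient n - 1 sees
    only \<open>u ^ k\<close> with k < n.\<close>
  have "fps_binomial (- of_nat n) oo u = inverse h ^ n"
    using u0
    by (simp add: fps_binomial_minus_of_nat fps_inverse_power fps_inverse_compose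
        fps_compose_add_distrib h flip: fps_compose_power)
  hence "fps_nth (inverse h ^ n) (n - 1) =
      (\<Sum>k=0..n-1. ((- of_nat n) gchoose k) * fps_nth (u ^ k) (n - 1))"
    by (simp add: fps_compose_nth flip: \<open>_ = inverse h ^ n\<close>)
  also have "\<dots> = (\<Sum>k=0..n-1. \<Sum>j=0..n-1.
      (-1) ^ j * of_nat (((n + k - 1) choose k) * (k choose j)) * fps_nth (h ^ j) (n - 1))"
  proof (intro sum.cong refl)
    fix k assume k: "k \<in> {0..n-1}"
    have "u ^ k = (\<Sum>j\<le>k. of_nat (k choose j) * h ^ j * (-1) ^ (k - j))"
      using binomial_ring[of h "-1" k] by (simp add: u_def)
    \<comment> \<open>For j > k the binomial is zero, so one range serves all k. The sign is put as
      (-1)^(k+j) so that its (-1)^k cancels the one in \<open>gc\<close>.\<close>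
    also have "\<dots> = (\<Sum>j=0..n-1. fps_const (of_nat (k choose j) * (-1) ^ (k + j)) * h ^ j)"
      using k
      by (intro sum.mono_neutral_cong_left)
         (auto simp: fps_of_nat [symmetric] power_add minus_one_power_iff
           simp flip: fps_const_neg)
    finally have uk: "fps_nth (u ^ k) (n - 1) =
        (\<Sum>j=0..n-1. of_nat (k choose j) * (-1) ^ (k + j) * fps_nth (h ^ j) (n - 1))"
      by (simp add: fps_sum_nth)
    have gc: "((- of_nat n) gchoose k) = ((-1) ^ k * of_nat ((n + k - 1) choose k) :: 'a)"
      using \<open>n > 0\<close> by (simp add: gbinomial_minus binomial_gbinomial of_nat_diff)
    show "((- of_nat n) gchoose k) * fps_nth (u ^ k) (n - 1) =
      (\<Sum>j=0..n-1. (-1) ^ j * of_nat (((n + k - 1) choose k) * (k choose j)) * fps_nth (h ^ j) (n - 1))"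
      unfolding uk gc sum_distrib_left
      by (intro sum.cong refl) (simp add: power_add mult_ac flip: power_mult_distrib)
  qed
  also have "\<dots> = (\<Sum>j=0..n-1. (-1) ^ j * of_nat (\<Sum>k=0..n-1. ((n + k - 1) choose k) * (k choose j))
      * fps_nth (h ^ j) (n - 1))"
    by (subst sum.swap) (simp add: sum_distrib_left sum_distrib_right)
  also have "\<dots> = (\<Sum>j=0..n-1. (-1) ^ j * of_nat (\<Sum>k=j..n-1. ((n + k - 1) choose k) * (k choose j))
      * fps_nth (h ^ j) (n - 1))"
    by (intro sum.cong refl arg_cong2[of _ _ _ _ "(*)"] arg_cong[of _ _ of_nat] sum.mono_neutral_right) auto
  also have "\<dots> = (\<Sum>j=0..n-1. (-1) ^ j * of_nat (((n + j - 1) choose j) * ((2 * n - 1) choose (n - 1 - j)))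
        * fps_nth (h ^ j) (n - 1))"
    using \<open>n > 0\<close> by (intro sum.cong refl, subst sum_choose_mult_choose) auto
  finally show ?thesis .
qed

text \<open>Normalising f to constant term 1 after removing X costs a^(-n) in Lagrange inversion and
  a^(-j) for each power \<open>f ^ j\<close>, whence the exponent n + j; the factor X^j shifts the
  coefficient index to n - 1 + j.\<close>

lemma fps_nth_compositional_inverse:
  fixes f g :: "'a :: field_char_0 fps"
  assumes f0: "fps_nth f 0 = 0" and f1: "fps_nth f 1 \<noteq> 0"
    and gf: "g oo f = fps_X" and "n > 0"
  shows "of_nat n * fps_nth g n =
    (\<Sum>j=0..n-1. (-1) ^ j * of_nat (((n + j - 1) choose j) * ((2 * n - 1) choose (n - 1 - j)))
        * fps_nth (f ^ j) (n - 1 + j) / fps_nth f 1 ^ (n + j))"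
proof -
  define a where "a = fps_nth f 1"
  define h where "h = fps_const (inverse a) * fps_shift 1 f"
  have a: "a \<noteq> 0"
    using f1 by (simp add: a_def)
  have h0: "fps_nth h 0 = 1"
    using a by (simp add: h_def a_def)
  have f: "f = fps_X * (fps_const a * h)"
    using a f0 by (auto simp: fps_eq_iff h_def mult.assoc [symmetric])
  have hj: "fps_nth (f ^ j) (n - 1 + j) = a ^ j * fps_nth (h ^ j) (n - 1)" for j
    by (simp add: f power_mult_distrib fps_X_power_mult_nth)
  have "of_nat n * fps_nth g n = fps_nth (inverse (fps_const a * h) ^ n) (n - 1)"
    using f gf \<open>n > 0\<close> a h0 by (intro fps_Lagrange_inversion) auto
  also have "\<dots> = fps_nth (inverse h ^ n) (n - 1) / a ^ n"
    using a by (simp add: fps_inverse_mult power_mult_distrib fps_const_inverse divide_inverse power_inverse)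
  also have "\<dots> = (\<Sum>j=0..n-1. (-1) ^ j * of_nat (((n + j - 1) choose j) * ((2 * n - 1) choose (n - 1 - j)))
        * fps_nth (f ^ j) (n - 1 + j) / a ^ (n + j))"
    unfolding fps_nth_inverse_power_eq_sum_powers[OF h0 \<open>n > 0\<close>] sum_divide_distrib hj
    using a by (intro sum.cong refl) (simp add: power_add)
  finally show ?thesis
    by (simp add: a_def)
qed

theorem theorem4p1:
  fixes M :: "'a measure" and Y :: "'a \<Rightarrow> real" and lam :: real
  assumes "prob_space M"
    and "Y \<in> borel_measurable M"
    and "mgf_exists_near_0 M Y"
    and "(\<integral>\<omega>. Y \<omega> \<partial>M) \<noteq> 0"
    and "lam \<noteq> 0"
  shows "prob_degenerate_log1p M Y lam =
    Abs_fps (\<lambda>n. if n \<ge> 1 then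
      (\<Sum>j=0..n-1. real ((2*n-1) choose (n-1-j)) * (-1)^j
          * (\<integral>\<omega>. Y \<omega> \<partial>M) powi (- int n - int j)
          * prob_degenerate_Stirling2 M Y lam (n-1+j) j) / fact n
      else 0)"
proof (rule fps_ext)
  fix n :: nat
  define a where "a = (\<integral>\<omega>. Y \<omega> \<partial>M)"
  define f where "f = prob_degenerate_exp M Y lam - 1"
  define g where "g = prob_degenerate_log1p M Y lam"
  define S where "S = prob_degenerate_Stirling2 M Y lam"
  have f0: "fps_nth f 0 = 0" and f1: "fps_nth f 1 = a"
    unfolding f_def a_def
    by (rule prob_degenerate_exp_nth_0[OF assms(1)], rule prob_degenerate_exp_nth_1)
  have gf: "g oo f = fps_X"
    unfolding f_def g_def by (rule prob_degenerate_log1p_compositional_inverse(1)[OF assms(1,4)])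
  have S: "fps_nth (f ^ j) m = fact j * S m j / fact m" for j m
    by (simp add: S_def prob_degenerate_Stirling2_def f_def)
  have "fps_nth g n = (\<Sum>j=0..n-1. real ((2*n-1) choose (n-1-j)) * (-1)^j
          * a powi (- int n - int j) * S (n-1+j) j) / fact n" if "n > 0"
  proof -
    have "real n * fps_nth g n =
        (\<Sum>j=0..n-1. (-1) ^ j * real (((n + j - 1) choose j) * ((2 * n - 1) choose (n - 1 - j)))
          * fps_nth (f ^ j) (n - 1 + j) / a ^ (n + j))"
      using fps_nth_compositional_inverse[OF f0 _ gf that] assms(4) f1 by (simp add: a_def)
    also have "\<dots> = (\<Sum>j=0..n-1. real ((2*n-1) choose (n-1-j)) * (-1)^j
          * a powi (- int n - int j) * S (n-1+j) j) / fact (n - 1)"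
      unfolding sum_divide_distrib
    proof (intro sum.cong refl)
      fix j
      \<comment> \<open>This binomial cancels the factorials that \<open>S\<close> introduces, up to
        1/(n-1)!. The factor n from Lagrange inversion then turns this into 1/n!.\<close>
      have "real ((n + j - 1) choose j) = fact (n - 1 + j) / (fact j * fact (n - 1))"
        using that by (simp add: binomial_fact)
      moreover have "a powi (- int n - int j) = inverse (a ^ (n + j))"
        using power_int_minus[of a "int (n + j)"] by (simp only: power_int_of_nat) simp
      ultimately show "(-1) ^ j * real (((n + j - 1) choose j) * ((2 * n - 1) choose (n - 1 - j)))
          * fps_nth (f ^ j) (n - 1 + j) / a ^ (n + j) =
          real ((2*n-1) choose (n-1-j)) * (-1)^j * a powi (- int n - int j) * S (n-1+j) j / fact (n - 1)"
        by (simp only: S of_nat_mult) (simp add: inverse_eq_divide mult_ac)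
    qed
    finally show ?thesis
      using that by (simp add: fact_reduce[of n] field_simps)
  qed
  \<comment> \<open>\<open>fps_inv\<close> sets the constant coefficient to 0, matching the
    \<open>else\<close> branch.\<close>
  moreover have "fps_nth g 0 = 0"
    by (simp add: g_def prob_degenerate_log1p_def fps_inv_def)
  ultimately show "fps_nth (prob_degenerate_log1p M Y lam) n = fps_nth (Abs_fps (\<lambda>n. if n \<ge> 1 then
      (\<Sum>j=0..n-1. real ((2*n-1) choose (n-1-j)) * (-1)^j
          * (\<integral>\<omega>. Y \<omega> \<partial>M) powi (- int n - int j)
          * prob_degenerate_Stirling2 M Y lam (n-1+j) j) / fact n
      else 0)) n"
    by (auto simp: g_def a_def S_def Suc_le_eq)
qed

end
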